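(* An element $x=(x_n)_{n\in\mathbb{N}}\in\ell_\infty$ is a right-symmetric point if and only if $|x_n|=\|x\|$ for every $n\in\mathbb{N}$.
   Context: $\mathbb{K}$ is $\mathbb{R}$ or $\mathbb{C}$. $\ell_\infty$ is the space of bounded sequences in $\mathbb{K}$ with the supremum norm $\|\cdot\|$. In a normed space $\mathbb{X}$ over $\mathbb{K}$, $x\perp_B y$ means $\|x+\lambda y\|\ge\|x\|$ for all $\lambda\in\mathbb{K}$. A point $x\in\mathbb{X}$ is right-symmetric if for every $y\in\mathbb{X}$, $y\perp_B x$ implies $x\perp_B y$. *)

theory Defs
  imports "HOL-Analysis.Analysis"
begin

text \<open>Every function on the discrete space \<^typ>\<open>nat\<close> is continuous, so the bounded continuous
  functions from \<^typ>\<open>nat\<close> to a scalar field are exactly the bounded sequences, and the library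
  norm on them is the supremum norm (lemma \<open>norm_linf\<close>).\<close>

type_synonym 'k linf = "(nat, 'k) bcontfun"

lemma norm_linf:
  fixes x :: "'k::real_normed_field linf"
  shows "norm x = (SUP n. norm (apply_bcontfun x n))"
  unfolding norm_bcontfun_def dist_bcontfun_def by simp

lemma range_apply_linf:
  "range (apply_bcontfun :: 'k::real_normed_field linf \<Rightarrow> _) = {x. bounded (range x)}"
  by (simp add: type_definition.Rep_range[OF type_definition_bcontfun] bcontfun_def)

text \<open>The library only provides real scalar multiplication on bounded continuous functions;
  over the complex numbers orthogonality quantifies over complex scalars.\<close>

definition linf_scale :: "'k::real_normed_field \<Rightarrow> 'k linf \<Rightarrow> 'k linf"
  where "linf_scale c x = Bcontfun (\<lambda>n. c * apply_bcontfun x n)"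

lemma apply_linf_scale [simp]:
  fixes x :: "'k::real_normed_field linf"
  shows "apply_bcontfun (linf_scale c x) n = c * apply_bcontfun x n"
proof -
  have "bounded ((\<lambda>y. c * y) ` range (apply_bcontfun x))"
    by (intro bounded_linear_image bounded_linear_mult_right bounded_apply_bcontfun)
  then have "(\<lambda>n. c * apply_bcontfun x n) \<in> bcontfun"
    by (simp add: bcontfun_def image_image)
  then show ?thesis
    by (simp add: linf_scale_def Bcontfun_inverse)
qed

lemma vector_space_linf_scale: "vector_space linf_scale"
  by unfold_locales (rule bcontfun_eqI, simp add: algebra_simps)+

lemma linf_scale_real: "linf_scale (c :: real) x = c *\<^sub>R x"
  by (rule bcontfun_eqI) simp

text \<open>The scalar multiplication is an explicit argument because no type class describes a normed
  space over the complex numbers.\<close>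

definition birkhoff_orthogonal ::
  "('k::real_normed_field \<Rightarrow> 'v \<Rightarrow> 'v) \<Rightarrow> 'v::real_normed_vector \<Rightarrow> 'v \<Rightarrow> bool"
  where "birkhoff_orthogonal smul x y \<longleftrightarrow> (\<forall>c. norm (x + smul c y) \<ge> norm x)"

definition right_symmetric ::
  "('k::real_normed_field \<Rightarrow> 'v \<Rightarrow> 'v) \<Rightarrow> 'v::real_normed_vector \<Rightarrow> bool"
  where "right_symmetric smul x \<longleftrightarrow>
    (\<forall>y. birkhoff_orthogonal smul y x \<longrightarrow> birkhoff_orthogonal smul x y)"

end

theory Submission
  imports Defs
begin

text \<open>
  Failure of \<open>x \<bottom>\<^sub>B y\<close> means that some multiple of \<open>y\<close>, added to \<open>x\<close>, brings every coordinate
  below one bound that is strictly smaller than \<open>\<parallel>x\<parallel>\<close>.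

  If all coordinates of \<open>x\<close> have modulus \<open>\<parallel>x\<parallel>\<close>, such a bound for \<open>x + c y\<close> forces the real inner
  product of \<open>x\<^sub>n\<close> and \<open>c y\<^sub>n\<close> to be negative, uniformly in \<open>n\<close>. Adding a small positive multiple
  of \<open>x\<close> to \<open>c y\<close> then shortens every coordinate by a uniform amount, so \<open>y \<bottom>\<^sub>B x\<close> fails
  as well (\<open>right_symmetric_if_constant_norm\<close>).

  If instead \<open>\<bar>x\<^sub>k\<bar> < \<parallel>x\<parallel>\<close> for some \<open>k\<close>, let \<open>y\<close> agree with \<open>x\<close> except that \<open>y\<^sub>k\<close> has modulus
  \<open>\<parallel>x\<parallel>\<close> and points opposite to \<open>x\<^sub>k\<close> (in any direction if \<open>x\<^sub>k = 0\<close>). Subtracting a small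
  multiple of \<open>y\<close> from \<open>x\<close> scales down all the other coordinates, and coordinate \<open>k\<close> has room to
  grow, so \<open>x \<bottom>\<^sub>B y\<close> fails. But \<open>y \<bottom>\<^sub>B x\<close> holds: adding \<open>c x\<close> scales \<open>y\<close> by \<open>1 + c\<close> away from
  \<open>k\<close>, where \<open>\<bar>x\<^sub>n\<bar>\<close> still has supremum \<open>\<parallel>x\<parallel>\<close>, so \<open>\<bar>1 + c\<bar> < 1\<close> is necessary for a shorter
  sum, and such a \<open>c\<close> does not shorten coordinate \<open>k\<close> (\<open>constant_norm_if_right_symmetric\<close>).

  Both arguments work over any normed field; the first one also uses that its norm comes from a
  real inner product.
\<close>

lemma not_birkhoff_orthogonal_linf_iff:
  fixes x y :: "'k::real_normed_field linf"
  shows "\<not> birkhoff_orthogonal linf_scale x y \<longleftrightarrow>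
    (\<exists>c. \<exists>\<rho><norm x. \<forall>n. norm (apply_bcontfun x n + c * apply_bcontfun y n) \<le> \<rho>)"
    (is "?L \<longleftrightarrow> ?R")
proof
  assume ?L
  then obtain c where c: "norm (x + linf_scale c y) < norm x"
    by (auto simp: birkhoff_orthogonal_def not_le)
  have "norm (apply_bcontfun x n + c * apply_bcontfun y n) \<le> norm (x + linf_scale c y)" for n
    using norm_bounded[of "x + linf_scale c y" n] by (simp add: plus_bcontfun.rep_eq)
  with c show ?R by blast
next
  assume ?R
  then obtain c \<rho> where \<rho>: "\<rho> < norm x"
    and le: "\<And>n. norm (apply_bcontfun x n + c * apply_bcontfun y n) \<le> \<rho>"
    by blast
  have "norm (x + linf_scale c y) \<le> \<rho>"
    by (rule norm_bound) (simp add: plus_bcontfun.rep_eq le)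
  with \<rho> have "\<not> norm x \<le> norm (x + linf_scale c y)" by linarith
  then show ?L
    unfolding birkhoff_orthogonal_def by blast
qed

text \<open>The bound \<open>M\<close> improves by an amount that does not depend on the individual \<open>b\<close>, so the
  gain is uniform over all coordinates of a sequence. The coefficient of \<open>a\<close> minimises the quadratic bound on the squared norm.\<close>

lemma norm_add_scaleR_uniform_decrease:
  fixes a b :: "'a::real_inner"
  assumes a: "norm a = r" and r: "r > 0"
    and sum_le: "norm (a + b) \<le> \<rho>"
    and b_le: "norm b \<le> M"
  defines "\<eta> \<equiv> r\<^sup>2 - \<rho>\<^sup>2"
  assumes \<eta>: "\<eta> \<ge> 0"
  shows "norm (b + (\<eta> / (2 * r\<^sup>2)) *\<^sub>R a) \<le> sqrt (M\<^sup>2 - \<eta>\<^sup>2 / (4 * r\<^sup>2))"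
proof -
  define s where "s = \<eta> / (2 * r\<^sup>2)"
  have s: "s \<ge> 0" using \<eta> by (simp add: s_def)
  have expand: "(norm (u + v))\<^sup>2 = (norm u)\<^sup>2 + 2 * (u \<bullet> v) + (norm v)\<^sup>2" for u v :: 'a
    by (simp add: power2_norm_eq_inner inner_add_left inner_add_right inner_commute)
  have "r\<^sup>2 + 2 * (a \<bullet> b) + (norm b)\<^sup>2 \<le> \<rho>\<^sup>2"
    using power_mono[OF sum_le, of 2] by (simp add: expand a)
  then have inner: "2 * (a \<bullet> b) \<le> - \<eta>"
    using zero_le_power2[of "norm b"] unfolding \<eta>_def by linarith
  have "(norm (b + s *\<^sub>R a))\<^sup>2 = (norm b)\<^sup>2 + s * (2 * (a \<bullet> b)) + s\<^sup>2 * r\<^sup>2"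
    by (simp add: expand a power_mult_distrib inner_commute)
  also have "\<dots> \<le> M\<^sup>2 + s * (- \<eta>) + s\<^sup>2 * r\<^sup>2"
    using mult_left_mono[OF inner s] power_mono[OF b_le, of 2] by simp
  also have "\<dots> = M\<^sup>2 - \<eta>\<^sup>2 / (4 * r\<^sup>2)"
    using r by (simp add: s_def field_simps power2_eq_square)
  finally show ?thesis
    unfolding s_def by (rule real_le_rsqrt)
qed

lemma right_symmetric_if_constant_norm:
  fixes x :: "'k::{real_inner, real_normed_field} linf"
  assumes x: "\<And>n. norm (apply_bcontfun x n) = norm x"
  shows "right_symmetric linf_scale x"
  unfolding right_symmetric_def
proof (intro allI impI, rule ccontr)
  fix y
  assume yx: "birkhoff_orthogonal linf_scale y x"
    and "\<not> birkhoff_orthogonal linf_scale x y"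
  then obtain c \<rho> where \<rho>: "\<rho> < norm x"
    and le: "\<And>n. norm (apply_bcontfun x n + c * apply_bcontfun y n) \<le> \<rho>"
    unfolding not_birkhoff_orthogonal_linf_iff by blast
  have "\<rho> \<ge> 0" using le[of 0] norm_ge_zero order_trans by blast
  with \<rho> have r: "norm x > 0" by linarith
  define \<eta> where "\<eta> = (norm x)\<^sup>2 - \<rho>\<^sup>2"
  have \<eta>: "\<eta> > 0"
    using power_strict_mono[OF \<rho> \<open>\<rho> \<ge> 0\<close>, of 2] by (simp add: \<eta>_def)
  have c: "c \<noteq> 0" using le[of 0] \<rho> x[of 0] by auto
  define s where "s = \<eta> / (2 * (norm x)\<^sup>2)"
  define M where "M = norm c * norm y"
  define B where "B = sqrt (M\<^sup>2 - \<eta>\<^sup>2 / (4 * (norm x)\<^sup>2))"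
  have B: "B < M"
  proof -
    have "M \<ge> 0" by (simp add: M_def)
    moreover have "\<eta>\<^sup>2 / (4 * (norm x)\<^sup>2) > 0" using r \<eta> by simp
    ultimately show ?thesis
      unfolding B_def by (intro real_less_lsqrt) auto
  qed
  have "norm (apply_bcontfun y n + of_real s / c * apply_bcontfun x n) \<le> B / norm c" for n
  proof -
    have "norm (c * apply_bcontfun y n) \<le> M"
      by (simp add: M_def norm_mult mult_left_mono norm_bounded)
    then have "norm (c * apply_bcontfun y n + s *\<^sub>R apply_bcontfun x n) \<le> B"
      using norm_add_scaleR_uniform_decrease[OF x r le, of n M] \<eta>
      by (simp add: s_def B_def \<eta>_def)
    also have "c * apply_bcontfun y n + s *\<^sub>R apply_bcontfun x n
        = c * (apply_bcontfun y n + of_real s / c * apply_bcontfun x n)"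
      using c by (simp add: field_simps scaleR_conv_of_real)
    finally show ?thesis
      using c by (simp add: norm_mult pos_le_divide_eq mult.commute)
  qed
  moreover have "B / norm c < norm y"
    using B c by (simp add: M_def field_simps)
  ultimately have "\<not> birkhoff_orthogonal linf_scale y x"
    unfolding not_birkhoff_orthogonal_linf_iff by blast
  with yx show False by contradiction
qed

lemma obtain_opposite_vector:
  fixes a :: "'k::real_normed_field"
  assumes "R \<ge> 0"
  obtains v where "norm v = R" "norm (v - a) = R + norm a"
proof (cases "a = 0")
  case True
  show ?thesis by (rule that[of "of_real R"]) (use True assms in auto)
next
  case False
  let ?v = "- ((R / norm a) *\<^sub>R a)"
  have "?v - a = - ((R / norm a + 1) *\<^sub>R a)"
    by (simp add: scaleR_add_left)
  then have "norm (?v - a) = \<bar>R / norm a + 1\<bar> * norm a"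
    by (simp only: norm_minus_cancel norm_scaleR)
  also have "\<dots> = R + norm a"
    using False assms by (simp add: field_simps)
  finally show ?thesis
    by (rule that[rotated]) (use False assms in simp)
qed

lemma constant_norm_if_right_symmetric:
  fixes x :: "'k::real_normed_field linf"
  assumes sym: "right_symmetric linf_scale x"
  shows "norm (apply_bcontfun x k) = norm x"
proof (rule ccontr)
  assume "norm (apply_bcontfun x k) \<noteq> norm x"
  then have xk: "norm (apply_bcontfun x k) < norm x"
    using norm_bounded[of x k] by linarith
  define R where "R = norm x"
  define t where "t = norm (apply_bcontfun x k)"
  have tR: "t < R" and t: "0 \<le> t" using xk by (auto simp: t_def R_def)
  obtain v where v: "norm v = R" and vx: "norm (v - apply_bcontfun x k) = R + t"
    using obtain_opposite_vector[of R "apply_bcontfun x k"] by (auto simp: R_def t_def)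
  have x_le: "norm (apply_bcontfun x n) \<le> R" for n
    unfolding R_def by (rule norm_bounded)
  define f where "f = (apply_bcontfun x)(k := v)"
  have f_le: "norm (f n) \<le> R" for n
    using x_le[of n] v by (simp add: f_def)
  then have "f \<in> bcontfun"
    by (auto simp: bcontfun_def bounded_iff)
  then obtain y where y: "apply_bcontfun y = f"
    by (metis Bcontfun_inverse)
  have y_le: "norm y \<le> R"
    by (rule norm_bound) (simp add: y f_le)
  have "birkhoff_orthogonal linf_scale y x"
  proof (rule ccontr)
    assume "\<not> ?thesis"
    then obtain c \<rho> where "\<rho> < norm y"
      and le: "\<And>n. norm (f n + c * apply_bcontfun x n) \<le> \<rho>"
      unfolding not_birkhoff_orthogonal_linf_iff y by blast
    with y_le have \<rho>: "\<rho> < R" by linarith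
    show False
    proof (cases "norm (1 + c) < 1")
      case True
      \<comment> \<open>Coordinate \<open>k\<close> cannot shrink: split \<open>v - x\<^sub>k = (v + c x\<^sub>k) - (1 + c) x\<^sub>k\<close>.\<close>
      have "R + t = norm ((v + c * apply_bcontfun x k) - (1 + c) * apply_bcontfun x k)"
        by (simp add: vx[symmetric] algebra_simps)
      also have "\<dots> \<le> norm (v + c * apply_bcontfun x k) + norm (1 + c) * t"
        unfolding t_def norm_mult[symmetric] by (rule norm_triangle_ineq4)
      also have "\<dots> \<le> \<rho> + t"
        using le[of k] mult_right_mono[of "norm (1 + c)" 1 t] True t by (simp add: f_def)
      finally show False using \<rho> by simp
    next
      case False
      have "norm (apply_bcontfun x n) \<le> max \<rho> t" for n
      proof (cases "n = k")
        case True
        then show ?thesis by (simp add: t_def)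
      next
        case n: False
        have "norm (apply_bcontfun x n) \<le> norm (1 + c) * norm (apply_bcontfun x n)"
          using mult_right_mono[of 1 "norm (1 + c)" "norm (apply_bcontfun x n)"] False by simp
        also have "\<dots> = norm (f n + c * apply_bcontfun x n)"
          using n by (simp add: f_def norm_mult[symmetric] algebra_simps)
        finally show ?thesis using le[of n] by simp
      qed
      then have "norm x \<le> max \<rho> t" by (rule norm_bound)
      then show False using \<rho> tR by (simp add: R_def)
    qed
  qed
  moreover have "\<not> birkhoff_orthogonal linf_scale x y"
    unfolding not_birkhoff_orthogonal_linf_iff y
  proof (intro exI conjI allI)
    \<comment> \<open>With this \<open>e\<close>, the bounds \<open>t + e R\<close> at \<open>k\<close> and \<open>(1 - e) R\<close> elsewhere coincide.\<close>
    define e where "e = (R - t) / (2 * R)"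
    have at_k: "t + e * R = (R + t) / 2" and off_k: "(1 - e) * R = (R + t) / 2"
      and e: "0 \<le> e" "e \<le> 1"
      using tR t by (auto simp: e_def field_simps)
    show "(R + t) / 2 < norm x" using tR by (simp add: R_def)
    show "norm (apply_bcontfun x n + of_real (- e) * f n) \<le> (R + t) / 2" for n
    proof (cases "n = k")
      case True
      have "norm (apply_bcontfun x k + of_real (- e) * v) \<le> t + e * R"
        using norm_triangle_ineq[of "apply_bcontfun x k" "of_real (- e) * v"] e
        by (simp add: norm_mult v t_def)
      also have "\<dots> = (R + t) / 2" by (rule at_k)
      finally show ?thesis using True by (simp add: f_def)
    next
      case False
      have "apply_bcontfun x n + of_real (- e) * f n = of_real (1 - e) * apply_bcontfun x n"
        using False by (simp add: f_def algebra_simps)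
      then have "norm (apply_bcontfun x n + of_real (- e) * f n)
          = \<bar>1 - e\<bar> * norm (apply_bcontfun x n)"
        by (simp only: norm_mult norm_of_real)
      also have "\<dots> \<le> (1 - e) * R"
        using e x_le[of n] by (simp add: mult_left_mono)
      also have "\<dots> = (R + t) / 2" by (rule off_k)
      finally show ?thesis .
    qed
  qed
  ultimately show False
    using sym by (auto simp: right_symmetric_def)
qed

theorem theorem2p11:
  fixes x :: "real linf" and z :: "complex linf"
  shows "(right_symmetric linf_scale x \<longleftrightarrow> (\<forall>n. norm (apply_bcontfun x n) = norm x)) \<and>
         (right_symmetric linf_scale z \<longleftrightarrow> (\<forall>n. norm (apply_bcontfun z n) = norm z))"
  using right_symmetric_if_constant_norm[of x] constant_norm_if_right_symmetric[of x]
    right_symmetric_if_constant_norm[of z] constant_norm_if_right_symmetric[of z]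
  by blast

end
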